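(* Let $\mathsf{H}_0\in\mathbb{R}$. The optimal privacy-aware estimator of the public random variable $Y$ is obtained by solving the following optimization problem over tuples $P=(P_i)_{i=1}^m$ of bounded measurable functions $P_i:\mathbb{R}\to\mathbb{R}$: $$\text{minimize } \mathsf{E}\big[L(Y,\hat Y_P(Z))\big]\quad\text{subject to}\quad P_i(z)\ge 0\ \ \forall i,z,\qquad \sum_{i=1}^m P_i(z)=1\ \ \forall z,\qquad \mathsf{H}[X\mid \hat Y_P(Z)]\ge \mathsf{H}_0 .$$ This problem is a convex optimization problem: as a function of $P$ the objective is linear (up to an additive constant), and the feasible set is convex.
   Context: $X$ (private) and $Y$ (public) are possibly correlated discrete random variables with finite support sets $\mathcal{X}=\{x_1,\dots,x_n\}$ and $\mathcal{Y}=\{y_1,\dots,y_m\}$. The measurement $Z$ is a real random variable, jointly distributed with $(X,Y)$, that is absolutely continuous with respect to Lebesgue measure with density $p_Z$. Randomized estimator: given measurable functions $P_i:\mathbb{R}\to[0,\infty)$, $i=1,\dots,m$, with $\sum_i P_i(z)=1$ for all $z$, $\hat Y_P(Z)$ is the $\mathcal{Y}$-valued random variable that, given $Z=z$, equals $y_i$ with probability $P_i(z)$, the randomization being conditionally independent of $(X,Y)$ given $Z$. Loss: $L(Y,\hat Y)=1$ if $Y\ne\hat Y$, and $0$ otherwise. Conditional entropy: $\mathsf{H}[X\mid \hat Y_P(Z)]=-\sum_{y\in\mathcal{Y}}\Pr(\hat Y_P(Z)=y)\sum_{x\in\mathcal{X}}\Pr(X=x\mid\hat Y_P(Z)=y)\log\Pr(X=x\mid\hat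 Y_P(Z)=y)$, with $0\log 0=0$ and terms with $\Pr(\hat Y_P(Z)=y)=0$ omitted. An optimal privacy-aware estimator is a randomized estimator minimizing the expected loss among all randomized estimators with $\mathsf{H}[X\mid\hat Y_P(Z)]\ge\mathsf{H}_0$. *)

theory Defs
  imports "HOL-Probability.Probability" "HOL-Library.Function_Algebras"
begin

text \<open>Pointwise real vector space structure on functions, so that \<^const>\<open>convex\<close> and
  \<^const>\<open>convex_on\<close> apply to tuples of real functions.\<close>

instantiation "fun" :: (type, real_vector) real_vector
begin

definition scaleR_fun :: "real \<Rightarrow> ('a \<Rightarrow> 'b) \<Rightarrow> 'a \<Rightarrow> 'b" where
  "scaleR_fun c f = (\<lambda>x. c *\<^sub>R f x)"

instance
  by standard (auto simp: scaleR_fun_def plus_fun_def fun_eq_iff scaleR_add_right scaleR_add_left)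

end

definition finite_discrete_rv :: "'w measure \<Rightarrow> ('w \<Rightarrow> 'a) \<Rightarrow> 'a set \<Rightarrow> bool" where
  "finite_discrete_rv M X S \<longleftrightarrow>
     X \<in> measurable M (count_space UNIV) \<and> finite S \<and>
     S = {a. \<P>(\<omega> in M. X \<omega> = a) > 0} \<and> (AE \<omega> in M. X \<omega> \<in> S)"

definition randomized_estimator :: "('m::finite \<Rightarrow> real \<Rightarrow> real) \<Rightarrow> bool" where
  "randomized_estimator P \<longleftrightarrow>
     (\<forall>i. P i \<in> borel_measurable borel) \<and> (\<forall>i z. 0 \<le> P i z) \<and> (\<forall>z. (\<Sum>i\<in>UNIV. P i z) = 1)"

text \<open>The probability space carrying the randomization: an outcome is a pair of an outcome
  \<open>\<omega>\<close> of \<open>M\<close> and a drawn index \<open>i\<close>. Given \<open>\<omega>\<close>, the index is \<open>i\<close> with probability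
  \<open>P i (Z \<omega>)\<close>, so the draw depends on \<open>\<omega>\<close> only through \<open>Z \<omega>\<close> and is conditionally
  independent, given \<open>Z\<close>, of every random variable on \<open>M\<close>. A random variable \<open>X\<close> on \<open>M\<close> becomes
  \<open>X \<circ> fst\<close>. The definition is meaningful only if \<open>P\<close> is a randomized estimator.\<close>

definition randomized_space ::
    "'w measure \<Rightarrow> ('w \<Rightarrow> real) \<Rightarrow> ('m::finite \<Rightarrow> real \<Rightarrow> real) \<Rightarrow> ('w \<times> 'm) measure" where
  "randomized_space M Z P =
     density (M \<Otimes>\<^sub>M count_space UNIV) (\<lambda>(\<omega>, i). ennreal (P i (Z \<omega>)))"

definition estimate :: "('m \<Rightarrow> 'b) \<Rightarrow> 'w \<times> 'm \<Rightarrow> 'b" where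
  "estimate y = y \<circ> snd"

definition loss :: "'b \<Rightarrow> 'b \<Rightarrow> real" where
  "loss b b' = (if b \<noteq> b' then 1 else 0)"

definition expected_loss ::
    "'w measure \<Rightarrow> ('w \<Rightarrow> 'b) \<Rightarrow> ('w \<Rightarrow> real) \<Rightarrow> ('m::finite \<Rightarrow> 'b) \<Rightarrow> ('m \<Rightarrow> real \<Rightarrow> real) \<Rightarrow> real"
  where
  "expected_loss M Y Z y P =
     (\<integral>\<xi>. loss (Y (fst \<xi>)) (estimate y \<xi>) \<partial>(randomized_space M Z P))"

text \<open>In nats. Since \<open>ln 0 = 0\<close>, the convention \<open>0 ln 0 = 0\<close> holds automatically; summands with
  \<open>\<P>(\<xi> in N. V \<xi> = b) = 0\<close> vanish because of their first factor.\<close>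

definition discrete_cond_entropy ::
    "'z measure \<Rightarrow> ('z \<Rightarrow> 'a) \<Rightarrow> 'a set \<Rightarrow> ('z \<Rightarrow> 'b) \<Rightarrow> 'b set \<Rightarrow> real" where
  "discrete_cond_entropy N U A V B =
     - (\<Sum>b\<in>B. \<P>(\<xi> in N. V \<xi> = b) *
          (\<Sum>a\<in>A. \<P>(\<xi> in N. U \<xi> = a \<bar> V \<xi> = b) * ln (\<P>(\<xi> in N. U \<xi> = a \<bar> V \<xi> = b))))"

definition estimator_entropy ::
    "'w measure \<Rightarrow> ('w \<Rightarrow> 'a) \<Rightarrow> ('w \<Rightarrow> real) \<Rightarrow> ('n::finite \<Rightarrow> 'a) \<Rightarrow> ('m::finite \<Rightarrow> 'b) \<Rightarrow>
      ('m \<Rightarrow> real \<Rightarrow> real) \<Rightarrow> real" where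
  "estimator_entropy M X Z x y P =
     discrete_cond_entropy (randomized_space M Z P) (X \<circ> fst) (range x) (estimate y) (range y)"

definition optimal_privacy_aware_estimator ::
    "'w measure \<Rightarrow> ('w \<Rightarrow> 'a) \<Rightarrow> ('w \<Rightarrow> 'b) \<Rightarrow> ('w \<Rightarrow> real) \<Rightarrow> ('n::finite \<Rightarrow> 'a) \<Rightarrow> ('m::finite \<Rightarrow> 'b) \<Rightarrow>
      real \<Rightarrow> ('m \<Rightarrow> real \<Rightarrow> real) \<Rightarrow> bool" where
  "optimal_privacy_aware_estimator M X Y Z x y H0 P \<longleftrightarrow>
     is_arg_min (expected_loss M Y Z y)
       (\<lambda>P. randomized_estimator P \<and> estimator_entropy M X Z x y P \<ge> H0) P"

definition bounded_measurable_tuples :: "('m::finite \<Rightarrow> real \<Rightarrow> real) set" where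
  "bounded_measurable_tuples = {P. \<forall>i. P i \<in> borel_measurable borel \<and> bounded (range (P i))}"

definition feasible_set ::
    "'w measure \<Rightarrow> ('w \<Rightarrow> 'a) \<Rightarrow> ('w \<Rightarrow> real) \<Rightarrow> ('n::finite \<Rightarrow> 'a) \<Rightarrow> ('m::finite \<Rightarrow> 'b) \<Rightarrow>
      real \<Rightarrow> ('m \<Rightarrow> real \<Rightarrow> real) set" where
  "feasible_set M X Z x y H0 =
     {P \<in> bounded_measurable_tuples.
        (\<forall>i z. P i z \<ge> 0) \<and> (\<forall>z. (\<Sum>i\<in>UNIV. P i z) = 1) \<and> estimator_entropy M X Z x y P \<ge> H0}"

definition linear_functional_on :: "'v::real_vector set \<Rightarrow> ('v \<Rightarrow> real) \<Rightarrow> bool" where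
  "linear_functional_on V l \<longleftrightarrow>
     (\<forall>u\<in>V. \<forall>v\<in>V. \<forall>a b. l (a *\<^sub>R u + b *\<^sub>R v) = a * l u + b * l v)"

lemma subspace_bounded_measurable_tuples:
  "subspace (bounded_measurable_tuples :: ('m::finite \<Rightarrow> real \<Rightarrow> real) set)"
proof -
  have 1: "bounded (range (\<lambda>z. f z + g z))" if "bounded (range f)" "bounded (range g)"
    for f g :: "real \<Rightarrow> real"
    using bounded_plus_comp[OF that] .
  have 2: "bounded (range (\<lambda>z. c * f z))" if "bounded (range f)" for f :: "real \<Rightarrow> real" and c
    using bounded_scaleR_comp[OF that, of c] by simp
  show ?thesis
    unfolding subspace_def bounded_measurable_tuples_def
    using 1 2 by (auto simp: zero_fun_def plus_fun_def scaleR_fun_def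
        intro!: borel_measurable_add borel_measurable_times)
qed

lemma emeasure_randomized_space:
  fixes P :: "'m::finite \<Rightarrow> real \<Rightarrow> real"
  assumes M: "prob_space M" and Z[measurable]: "Z \<in> borel_measurable M"
    and P: "randomized_estimator P" and A[measurable]: "A \<in> sets M"
  shows "emeasure (randomized_space M Z P) (A \<times> {i}) = (\<integral>\<^sup>+\<omega>\<in>A. ennreal (P i (Z \<omega>)) \<partial>M)"
proof -
  interpret prob_space M by fact
  interpret C: sigma_finite_measure "count_space (UNIV :: 'm set)"
    by (rule sigma_finite_measure_count_space_finite) simp
  have [measurable]: "P j \<in> borel_measurable borel" for j
    using P by (simp add: randomized_estimator_def)
  have f[measurable]: "(\<lambda>(\<omega>, j). ennreal (P j (Z \<omega>))) \<in> borel_measurable (M \<Otimes>\<^sub>M count_space UNIV)"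
    unfolding case_prod_beta'
    by (rule measurable_compose_countable'[where I = UNIV and g = snd
          and f = "\<lambda>j \<xi>. ennreal (P j (Z (fst \<xi>)))"]) (auto intro: countable_finite)
  have "emeasure (randomized_space M Z P) (A \<times> {i}) =
      (\<integral>\<^sup>+\<xi>. (case \<xi> of (\<omega>, j) \<Rightarrow> ennreal (P j (Z \<omega>))) * indicator (A \<times> {i}) \<xi>
         \<partial>(M \<Otimes>\<^sub>M count_space UNIV))"
    unfolding randomized_space_def by (rule emeasure_density[OF f]) (simp add: A)
  also have "\<dots> = (\<integral>\<^sup>+\<omega>. \<integral>\<^sup>+j. ennreal (P j (Z \<omega>)) * indicator (A \<times> {i}) (\<omega>, j)
         \<partial>count_space UNIV \<partial>M)"
    by (subst C.nn_integral_fst[symmetric]) (auto simp: A)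
  also have "\<dots> = (\<integral>\<^sup>+\<omega>\<in>A. ennreal (P i (Z \<omega>)) \<partial>M)"
    by (intro nn_integral_cong)
       (auto simp: nn_integral_count_space_finite indicator_times if_distrib indicator_def
             cong: if_cong)
  finally show ?thesis .
qed

end

theory Submission
  imports Defs
begin

text \<open>For an event \<open>A\<close> of \<open>M\<close>, the probability of \<open>A\<close> and the draw \<open>i\<close> together is
  \<open>\<integral>\<^sub>A P\<^sub>i(Z)\<close>, which is linear in \<open>P\<close>. The expected loss is a sum of such terms. The entropy is
  minus a sum of terms \<open>u ln (u / v)\<close>, where \<open>u\<close> and \<open>v\<close> are such terms; since \<open>u ln (u / v)\<close> is
  positively homogeneous and subadditive in \<open>(u, v)\<close> (the log-sum inequality), the entropy is
  concave and its superlevel sets are convex.\<close>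

text \<open>The left side is the tangent plane of \<open>u * ln (u / v)\<close> along the ray
  \<open>u = r * v\<close>; by homogeneity of degree 1 it has no constant term. For
  \<open>u > 0\<close>, that it lies below the function is \<open>ln a <= a - 1\<close> at
  \<open>a = r * v / u\<close>.\<close>

lemma rel_entropy_tangent:
  fixes u v r :: real
  assumes "0 \<le> u" "u \<le> v" "0 < r"
  shows "u * ln r + u - r * v \<le> u * ln (u / v)"
proof (cases "u = 0")
  case False
  then have pos: "0 < u" "0 < v"
    using assms by auto
  have "ln (r * v / u) \<le> r * v / u - 1"
    using pos assms by (intro ln_le_minus_one) simp
  then have "u * ln (r * v / u) \<le> r * v - u"
    using pos mult_left_mono[of _ _ u] by (fastforce simp: field_simps)
  moreover have "ln (r * v / u) = ln r - ln (u / v)"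
    using pos assms by (simp add: ln_div ln_mult)
  ultimately show ?thesis
    by (simp add: algebra_simps)
qed (use assms in simp)

lemma log_sum_inequality:
  fixes u\<^sub>1 u\<^sub>2 v\<^sub>1 v\<^sub>2 :: real
  assumes "0 \<le> u\<^sub>1" "u\<^sub>1 \<le> v\<^sub>1" "0 \<le> u\<^sub>2" "u\<^sub>2 \<le> v\<^sub>2"
  shows "(u\<^sub>1 + u\<^sub>2) * ln ((u\<^sub>1 + u\<^sub>2) / (v\<^sub>1 + v\<^sub>2)) \<le> u\<^sub>1 * ln (u\<^sub>1 / v\<^sub>1) + u\<^sub>2 * ln (u\<^sub>2 / v\<^sub>2)"
proof (cases "u\<^sub>1 + u\<^sub>2 = 0")
  case True
  then have "u\<^sub>1 = 0" "u\<^sub>2 = 0"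
    using assms by auto
  then show ?thesis
    by simp
next
  case False
  \<comment> \<open>With the ratio of the totals as common slope, the two tangent bounds add up to
    the left side exactly: the leftover \<open>u - r * v\<close> terms cancel.\<close>
  define r where "r = (u\<^sub>1 + u\<^sub>2) / (v\<^sub>1 + v\<^sub>2)"
  have "0 < v\<^sub>1 + v\<^sub>2"
    using False assms by linarith
  then have "0 < r" and r: "r * (v\<^sub>1 + v\<^sub>2) = u\<^sub>1 + u\<^sub>2"
    using False assms by (auto simp: r_def)
  show ?thesis
    using rel_entropy_tangent[OF assms(1,2) \<open>0 < r\<close>] rel_entropy_tangent[OF assms(3,4) \<open>0 < r\<close>] r
    unfolding r_def[symmetric] by (simp add: algebra_simps)
qed

text \<open>Homogeneity lets the weights be absorbed into the arguments, so subadditivity becomes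
  convexity.\<close>

lemma rel_entropy_convex:
  fixes u\<^sub>1 u\<^sub>2 v\<^sub>1 v\<^sub>2 s t :: real
  assumes "0 \<le> u\<^sub>1" "u\<^sub>1 \<le> v\<^sub>1" "0 \<le> u\<^sub>2" "u\<^sub>2 \<le> v\<^sub>2" "0 \<le> s" "0 \<le> t"
  shows "(s * u\<^sub>1 + t * u\<^sub>2) * ln ((s * u\<^sub>1 + t * u\<^sub>2) / (s * v\<^sub>1 + t * v\<^sub>2))
    \<le> s * (u\<^sub>1 * ln (u\<^sub>1 / v\<^sub>1)) + t * (u\<^sub>2 * ln (u\<^sub>2 / v\<^sub>2))"
proof -
  have scale: "c * u * ln (c * u / (c * v)) = c * (u * ln (u / v))" for c u v :: real
    by (cases "c = 0") auto
  show ?thesis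
    using log_sum_inequality[of "s * u\<^sub>1" "s * v\<^sub>1" "t * u\<^sub>2" "t * v\<^sub>2"] assms
    unfolding scale by (simp add: mult_left_mono)
qed

text \<open>An integral over \<open>M\<close>, rather than a measure in
  \<open>randomized_space\<close>, makes sense for signed tuples too, so it can be a linear
  functional on all of \<open>bounded_measurable_tuples\<close>.\<close>

definition draw_mass ::
    "'w measure \<Rightarrow> ('w \<Rightarrow> real) \<Rightarrow> 'w set \<Rightarrow> 'm::finite \<Rightarrow> ('m \<Rightarrow> real \<Rightarrow> real) \<Rightarrow> real" where
  "draw_mass M Z A i P = (\<integral>\<omega>. indicator A \<omega> * P i (Z \<omega>) \<partial>M)"

lemma randomized_estimator_le_1:
  assumes "randomized_estimator P"
  shows "P i z \<le> 1"
  using member_le_sum[of i UNIV "\<lambda>j. P j z"] assms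
  by (simp add: randomized_estimator_def)

lemma randomized_estimator_bounded:
  assumes "randomized_estimator P"
  shows "P \<in> bounded_measurable_tuples"
proof -
  have "bounded (range (P i))" for i
    unfolding bounded_iff
    using assms randomized_estimator_le_1[OF assms]
    by (auto simp: randomized_estimator_def intro!: exI[of _ 1])
  then show ?thesis
    using assms by (auto simp: bounded_measurable_tuples_def randomized_estimator_def)
qed

text \<open>Nonnegative functions summing to 1 have values in [0, 1], so the boundedness demanded in
  \<open>feasible_set\<close> is automatic. This identifies the optimization problem with the
  definition of an optimal estimator.\<close>

lemma feasible_set_iff:
  "P \<in> feasible_set M X Z x y H\<^sub>0 \<longleftrightarrow>
     randomized_estimator P \<and> H\<^sub>0 \<le> estimator_entropy M X Z x y P"
  using randomized_estimator_bounded[of P]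
  by (auto simp: feasible_set_def randomized_estimator_def bounded_measurable_tuples_def)

lemma randomized_estimator_convex_combination:
  assumes "randomized_estimator P" "randomized_estimator Q" "0 \<le> s" "0 \<le> t" "s + t = 1"
  shows "randomized_estimator (s *\<^sub>R P + t *\<^sub>R Q)"
  using assms
  by (auto simp: randomized_estimator_def plus_fun_def scaleR_fun_def sum.distrib
      intro!: borel_measurable_add borel_measurable_times simp flip: sum_distrib_left)

context prob_space
begin

context
  fixes Z :: "'a \<Rightarrow> real"
  assumes Z [measurable]: "Z \<in> borel_measurable M"
begin

lemma integrable_draw_mass:
  assumes "P \<in> bounded_measurable_tuples" and [measurable]: "A \<in> sets M"
  shows "integrable M (\<lambda>\<omega>. indicator A \<omega> * P i (Z \<omega>))"
proof -
  have [measurable]: "P i \<in> borel_measurable borel"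
    using assms by (simp add: bounded_measurable_tuples_def)
  obtain B where B: "\<And>z. \<bar>P i z\<bar> \<le> B"
    using assms(1) by (fastforce simp: bounded_measurable_tuples_def bounded_iff)
  then have "0 \<le> B"
    using abs_ge_zero order_trans by blast
  with B show ?thesis
    by (intro integrable_const_bound[where B = B]) (auto simp: indicator_def)
qed

lemma draw_mass_linear:
  assumes "A \<in> sets M"
  shows "linear_functional_on bounded_measurable_tuples (draw_mass M Z A i)"
  unfolding linear_functional_on_def
proof (intro ballI allI)
  fix P Q :: "'b \<Rightarrow> real \<Rightarrow> real" and s t
  assume PQ: "P \<in> bounded_measurable_tuples" "Q \<in> bounded_measurable_tuples"
  have "draw_mass M Z A i (s *\<^sub>R P + t *\<^sub>R Q)
      = (\<integral>\<omega>. s * (indicator A \<omega> * P i (Z \<omega>)) + t * (indicator A \<omega> * Q i (Z \<omega>)) \<partial>M)"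
    by (simp add: draw_mass_def plus_fun_def scaleR_fun_def algebra_simps)
  also have "\<dots> = s * draw_mass M Z A i P + t * draw_mass M Z A i Q"
    using PQ assms unfolding draw_mass_def
    by (simp add: integrable_draw_mass)
  finally show "draw_mass M Z A i (s *\<^sub>R P + t *\<^sub>R Q)
      = s * draw_mass M Z A i P + t * draw_mass M Z A i Q" .
qed

context
  fixes P :: "'m::finite \<Rightarrow> real \<Rightarrow> real"
  assumes P: "randomized_estimator P"
begin

lemma draw_mass_nonneg: "0 \<le> draw_mass M Z A i P"
  using P by (auto simp: draw_mass_def randomized_estimator_def intro!: integral_nonneg_AE)

text \<open>Supplies the hypothesis \<open>u <= v\<close> of \<open>rel_entropy_convex\<close>, with
  joint masses as \<open>u\<close> and the marginal of the draw as \<open>v\<close>.\<close>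

lemma draw_mass_le_space:
  assumes "A \<in> sets M"
  shows "draw_mass M Z A i P \<le> draw_mass M Z (space M) i P"
  unfolding draw_mass_def
  using P assms
  by (intro integral_mono integrable_draw_mass randomized_estimator_bounded)
     (auto simp: randomized_estimator_def indicator_def dest: sets.sets_into_space)

lemma emeasure_draw:
  assumes [measurable]: "A \<in> sets M"
  shows "emeasure (randomized_space M Z P) (A \<times> {i}) = ennreal (draw_mass M Z A i P)"
proof -
  have "emeasure (randomized_space M Z P) (A \<times> {i}) = (\<integral>\<^sup>+\<omega>\<in>A. ennreal (P i (Z \<omega>)) \<partial>M)"
    by (rule emeasure_randomized_space[OF prob_space_axioms Z P assms])
  also have "\<dots> = (\<integral>\<^sup>+\<omega>. ennreal (indicator A \<omega> * P i (Z \<omega>)) \<partial>M)"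
    by (intro nn_integral_cong) (auto simp: indicator_def)
  also have "\<dots> = ennreal (draw_mass M Z A i P)"
    unfolding draw_mass_def using P
    by (intro nn_integral_eq_integral integrable_draw_mass randomized_estimator_bounded)
       (auto simp: randomized_estimator_def)
  finally show ?thesis .
qed

lemma measure_draw:
  assumes "A \<in> sets M"
  shows "measure (randomized_space M Z P) (A \<times> {i}) = draw_mass M Z A i P"
  by (simp add: measure_def emeasure_draw[OF assms] draw_mass_nonneg)

lemma space_randomized_space: "space (randomized_space M Z P) = space M \<times> UNIV"
  by (simp add: randomized_space_def space_pair_measure)

lemma sets_randomized_space:
  "sets (randomized_space M Z P) = sets (M \<Otimes>\<^sub>M count_space UNIV)"
  by (simp add: randomized_space_def)

text \<open>The loss is the indicator of an error event, which splits by the drawn index into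
  disjoint rectangles.\<close>

lemma expected_loss_eq_sum:
  assumes [measurable]: "Y \<in> measurable M (count_space UNIV)"
  shows "expected_loss M Y Z y P = (\<Sum>i\<in>UNIV. draw_mass M Z {\<omega> \<in> space M. Y \<omega> \<noteq> y i} i P)"
proof -
  let ?N = "randomized_space M Z P"
  let ?A = "\<lambda>i. {\<omega> \<in> space M. Y \<omega> \<noteq> y i}"
  have A [measurable]: "?A i \<in> sets M" for i
    by measurable
  have sets: "?A i \<times> {i} \<in> sets ?N" for i
    unfolding sets_randomized_space using A by auto
  have "expected_loss M Y Z y P = (\<integral>\<xi>. indicator (\<Union>i. ?A i \<times> {i}) \<xi> \<partial>?N)"
    unfolding expected_loss_def
    by (intro Bochner_Integration.integral_cong)
       (auto simp: loss_def estimate_def indicator_def space_randomized_space)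
  also have "\<dots> = measure ?N (\<Union>i. ?A i \<times> {i})"
    using sets sets.sets_into_space[OF sets] by (auto simp: Int_absorb2 UN_subset_iff)
  also have "\<dots> = (\<Sum>i\<in>UNIV. measure ?N (?A i \<times> {i}))"
    using sets by (intro measure_finite_Union) (auto simp: disjoint_family_on_def emeasure_draw A)
  finally show ?thesis
    by (simp add: measure_draw A)
qed

text \<open>The weight \<open>v\<close> of a draw cancels against the denominator of the conditional
  probability \<open>u / v\<close> in front of the logarithm.\<close>

lemma estimator_entropy_eq_sum:
  fixes x :: "'n::finite \<Rightarrow> 'c" and y :: "'m \<Rightarrow> 'b"
  assumes [measurable]: "X \<in> measurable M (count_space UNIV)" and "inj x" "inj y"
  shows "estimator_entropy M X Z x y P = - (\<Sum>i\<in>UNIV. \<Sum>k\<in>UNIV.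
    draw_mass M Z {\<omega> \<in> space M. X \<omega> = x k} i P *
      ln (draw_mass M Z {\<omega> \<in> space M. X \<omega> = x k} i P / draw_mass M Z (space M) i P))"
proof -
  let ?N = "randomized_space M Z P"
  have V: "\<P>(\<xi> in ?N. estimate y \<xi> = y i) = draw_mass M Z (space M) i P" for i
  proof -
    \<comment> \<open>Injectivity of \<open>y\<close> matters here: distinct indices sharing a value
      would merge several draws into one event.\<close>
    have "{\<xi> \<in> space ?N. estimate y \<xi> = y i} = space M \<times> {i}"
      using \<open>inj y\<close> by (auto simp: space_randomized_space estimate_def inj_eq)
    then show ?thesis
      by (simp add: measure_draw)
  qed
  have UV: "\<P>(\<xi> in ?N. (X \<circ> fst) \<xi> = a \<and> estimate y \<xi> = y i)
      = draw_mass M Z {\<omega> \<in> space M. X \<omega> = a} i P" for a i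
  proof -
    have "{\<xi> \<in> space ?N. (X \<circ> fst) \<xi> = a \<and> estimate y \<xi> = y i} = {\<omega> \<in> space M. X \<omega> = a} \<times> {i}"
      using \<open>inj y\<close> by (auto simp: space_randomized_space estimate_def inj_eq)
    then show ?thesis
      by (simp add: measure_draw)
  qed
  \<comment> \<open>For \<open>v = 0\<close> both sides vanish, because \<open>u / 0 = 0\<close> and \<open>ln 0 = 0\<close>.\<close>
  have "v * (u / v * ln (u / v)) = u * ln (u / v)" for u v :: real
    by simp
  then show ?thesis
    unfolding estimator_entropy_def discrete_cond_entropy_def cond_prob_def
    using assms by (simp only: sum.reindex o_def[of _ x] o_def[of _ y] V UV sum_distrib_left)
qed

end

text \<open>Mixing estimators mixes the numerator and the denominator of every ratio with the same
  weights, so \<open>rel_entropy_convex\<close> applies to each summand; the minus sign turns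
  convexity into concavity.\<close>

lemma estimator_entropy_concave:
  fixes x :: "'n::finite \<Rightarrow> 'c" and y :: "'m::finite \<Rightarrow> 'b"
  assumes X [measurable]: "X \<in> measurable M (count_space UNIV)" and "inj x" "inj y"
    and P: "randomized_estimator P" and Q: "randomized_estimator Q"
    and st: "0 \<le> s" "0 \<le> t" "s + t = 1"
  shows "s * estimator_entropy M X Z x y P + t * estimator_entropy M X Z x y Q
    \<le> estimator_entropy M X Z x y (s *\<^sub>R P + t *\<^sub>R Q)"
proof -
  have lin: "draw_mass M Z A i (s *\<^sub>R P + t *\<^sub>R Q)
      = s * draw_mass M Z A i P + t * draw_mass M Z A i Q" if "A \<in> sets M" for A i
    using draw_mass_linear[OF that, of i] randomized_estimator_bounded[OF P]
      randomized_estimator_bounded[OF Q]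
    by (simp add: linear_functional_on_def)
  have A: "{\<omega> \<in> space M. X \<omega> = x k} \<in> sets M" for k
    by measurable
  note H = estimator_entropy_eq_sum[OF _ X \<open>inj x\<close> \<open>inj y\<close>]
  show ?thesis
    unfolding H[OF P] H[OF Q] H[OF randomized_estimator_convex_combination[OF P Q st]]
      lin[OF A] lin[OF sets.top] mult_minus_right minus_add_distrib[symmetric] neg_le_iff_le
      sum_distrib_left sum.distrib[symmetric]
    by (intro sum_mono rel_entropy_convex draw_mass_nonneg draw_mass_le_space P Q A st)
qed

end

end

theorem theorem1:
  fixes M :: "'w measure" and X :: "'w \<Rightarrow> 'a" and Y :: "'w \<Rightarrow> 'b" and Z :: "'w \<Rightarrow> real"
    and p\<^sub>Z :: "real \<Rightarrow> real"
    and x :: "'n::finite \<Rightarrow> 'a" and y :: "'m::finite \<Rightarrow> 'b"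
    and H\<^sub>0 :: real
  assumes "prob_space M"
    and "inj x" and "finite_discrete_rv M X (range x)"
    and "inj y" and "finite_discrete_rv M Y (range y)"
    and "\<And>z. p\<^sub>Z z \<ge> 0" and "distributed M lborel Z (\<lambda>z. ennreal (p\<^sub>Z z))"
  shows "(\<forall>P. optimal_privacy_aware_estimator M X Y Z x y H\<^sub>0 P \<longleftrightarrow>
            is_arg_min (expected_loss M Y Z y) (\<lambda>P. P \<in> feasible_set M X Z x y H\<^sub>0) P)
       \<and> (\<exists>l c. linear_functional_on bounded_measurable_tuples l \<and>
            (\<forall>P. randomized_estimator P \<longrightarrow> expected_loss M Y Z y P = l P + c))
       \<and> convex (feasible_set M X Z x y H\<^sub>0)
       \<and> convex_on (feasible_set M X Z x y H\<^sub>0) (expected_loss M Y Z y)"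
proof -
  interpret prob_space M by fact
  have X: "X \<in> measurable M (count_space UNIV)" and Y [measurable]: "Y \<in> measurable M (count_space UNIV)"
    using assms by (auto simp: finite_discrete_rv_def)
  have Z: "Z \<in> borel_measurable M"
    using assms(7) by (auto simp: distributed_def)
  let ?F = "feasible_set M X Z x y H\<^sub>0"
  \<comment> \<open>Extends the error probability linearly beyond the randomized estimators.\<close>
  define l where "l P = (\<Sum>i\<in>UNIV. draw_mass M Z {\<omega> \<in> space M. Y \<omega> \<noteq> y i} i P)" for P
  have l: "expected_loss M Y Z y P = l P" if "randomized_estimator P" for P
    unfolding l_def by (rule expected_loss_eq_sum[OF Z that Y])
  have "linear_functional_on bounded_measurable_tuples
      (draw_mass M Z {\<omega> \<in> space M. Y \<omega> \<noteq> y i} i)" for i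
    by (rule draw_mass_linear[OF Z]) measurable
  then have lin: "linear_functional_on bounded_measurable_tuples l"
    by (simp add: linear_functional_on_def l_def sum.distrib sum_distrib_left)
  have conv: "convex ?F"
  proof (rule convexI)
    fix P Q and s t :: real
    assume PQ: "P \<in> ?F" "Q \<in> ?F" and st: "0 \<le> s" "0 \<le> t" "s + t = 1"
    \<comment> \<open>Splitting the threshold with the same weights allows a termwise comparison
      with the two entropies.\<close>
    have "H\<^sub>0 = s * H\<^sub>0 + t * H\<^sub>0"
      using st by (simp flip: distrib_right)
    also have "\<dots> \<le> s * estimator_entropy M X Z x y P + t * estimator_entropy M X Z x y Q"
      using PQ st by (intro add_mono mult_left_mono) (auto simp: feasible_set_iff)
    also have "\<dots> \<le> estimator_entropy M X Z x y (s *\<^sub>R P + t *\<^sub>R Q)"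
      using PQ st assms X Z by (intro estimator_entropy_concave) (auto simp: feasible_set_iff)
    finally show "s *\<^sub>R P + t *\<^sub>R Q \<in> ?F"
      using PQ st by (simp add: feasible_set_iff randomized_estimator_convex_combination)
  qed
  have "convex_on ?F (expected_loss M Y Z y)"
    unfolding convex_on_def
  proof (intro conjI conv ballI allI impI)
    fix P Q and s t :: real
    assume PQ: "P \<in> ?F" "Q \<in> ?F" and st: "0 \<le> s" "0 \<le> t" "s + t = 1"
    then have re: "randomized_estimator P" "randomized_estimator Q"
      by (auto simp: feasible_set_iff)
    \<comment> \<open>The convexity inequality holds with equality, since the mixture is again a
      randomized estimator and the loss there is \<open>l\<close>.\<close>
    have "l (s *\<^sub>R P + t *\<^sub>R Q) = s * l P + t * l Q"
      using lin re[THEN randomized_estimator_bounded] by (auto simp: linear_functional_on_def)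
    with re st show "expected_loss M Y Z y (s *\<^sub>R P + t *\<^sub>R Q)
        \<le> s * expected_loss M Y Z y P + t * expected_loss M Y Z y Q"
      by (simp add: l randomized_estimator_convex_combination)
  qed
  moreover have "\<exists>l c. linear_functional_on bounded_measurable_tuples l \<and>
      (\<forall>P. randomized_estimator P \<longrightarrow> expected_loss M Y Z y P = l P + c)"
    \<comment> \<open>The additive constant is 0 because \<open>l\<close> sums the error masses
      directly, instead of subtracting the probability of a correct estimate from 1.\<close>
    using lin l by (intro exI[of _ l] exI[of _ 0]) simp
  ultimately show ?thesis
    using conv by (simp add: optimal_privacy_aware_estimator_def feasible_set_iff)
qed

end
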